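(* Let $\mu_1>\mu_2$ be real numbers, $\delta=\mu_1-\mu_2$, $\sigma_1,\sigma_2>0$ and $p\in(0,1)$. For the randomized static (RS) algorithm with parameter $p$ on the two-design problem with independent normal samples $\mathcal{N}(\mu_i,\sigma_i^2)$, $i=1,2$, $$-\lim_{T\to\infty}\frac1T\log\mathrm{PFS}_{\mathrm{RS}}(T)=\inf_{\alpha\in[0,1]}\left\{\frac{\delta^2}{2\left(\frac{\sigma_1^2}{\alpha}+\frac{\sigma_2^2}{1-\alpha}\right)}+kl(\alpha,p)\right\},$$ where $kl(\alpha,p)=\alpha\log\frac{\alpha}{p}+(1-\alpha)\log\frac{1-\alpha}{1-p}$ is the Kullback–Leibler divergence between Bernoulli distributions with parameters $\alpha$ and $p$.
   Context: There are $K=2$ designs. For $i=1,2$, the samples $X_{i1},X_{i2},\dots$ are i.i.d. $\mathcal{N}(\mu_i,\sigma_i^2)$, and the two sequences are independent. $\bar X_{i,n}=\frac1n\sum_{r=1}^nX_{ir}$. The RS algorithm with parameter $p$ and budget $T$ simulates, at each iteration $\ell=1,\dots,T$, design 1 if $U(\ell)=1$ and design 2 if $U(\ell)=0$, where the $U(\ell)$ are i.i.d. Bernoulli$(p)$ and independent of the samples; in addition each design is sampled once more, so that the sample means are well defined: $N_1=\sum_{\ell=1}^TU(\ell)+1$ and $N_2=T-\sum_{\ell=1}^TU(\ell)+1$. It outputs $\arg\max_{i\in\{1,2\}}\bar X_{i,N_i}$. The probability of false selection is $\mathrm{PFS}_{\mathrm{RS}}(T)=\mathbb{P}(\bar X_{1,N_1}<\bar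 X_{2,N_2})$. Conventions: $0\log0=0$, and the first term in the braces is $0$ at $\alpha=0$ and $\alpha=1$. *)

theory Defs
  imports "HOL-Probability.Probability"
begin

text \<open>
  Designs, samples and iterations are all indexed from 1: \<open>X i r\<close> is the \<open>r\<close>-th sample of
  design \<open>i\<close> (\<open>i = 1, 2\<close>), and \<open>U l\<close> is the randomization of iteration \<open>l\<close>, with \<open>True\<close> for
  the value 1 (simulate design 1) and \<open>False\<close> for the value 0 (simulate design 2).
  The scale parameter \<open>\<sigma> i\<close> is a standard deviation. The assumption \<open>indep\<close> is joint
  independence of all the samples and all the (0/1-valued) randomizations.
\<close>

locale two_design_rs = prob_space M
  for M :: "'a measure"
    and X :: "nat \<Rightarrow> nat \<Rightarrow> 'a \<Rightarrow> real"
    and U :: "nat \<Rightarrow> 'a \<Rightarrow> bool"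
    and \<mu> \<sigma> :: "nat \<Rightarrow> real"
    and p :: real +
  assumes sample_distr:
      "\<And>i r. i \<in> {1, 2} \<Longrightarrow> r \<ge> 1 \<Longrightarrow>
         distributed M lborel (X i r) (normal_density (\<mu> i) (\<sigma> i))"
    and U_distr:
      "\<And>l. l \<ge> 1 \<Longrightarrow> distr M (count_space UNIV) (U l) = measure_pmf (bernoulli_pmf p)"
    and indep:
      "indep_vars (\<lambda>_. borel)
         (\<lambda>k \<omega>. case k of Inl (i, r) \<Rightarrow> X i r \<omega> | Inr l \<Rightarrow> (of_bool (U l \<omega>) :: real))
         (({1, 2} \<times> {1..}) <+> {1..})"

definition sample_mean :: "(nat \<Rightarrow> nat \<Rightarrow> 'a \<Rightarrow> real) \<Rightarrow> nat \<Rightarrow> nat \<Rightarrow> 'a \<Rightarrow> real" where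
  "sample_mean X i n \<omega> = (\<Sum>r=1..n. X i r \<omega>) / real n"

definition N1 :: "(nat \<Rightarrow> 'a \<Rightarrow> bool) \<Rightarrow> nat \<Rightarrow> 'a \<Rightarrow> nat" where
  "N1 U T \<omega> = (\<Sum>l=1..T. of_bool (U l \<omega>)) + 1"

text \<open>The subtraction on \<open>nat\<close> does not truncate, since the sum is at most \<open>T\<close>.\<close>

definition N2 :: "(nat \<Rightarrow> 'a \<Rightarrow> bool) \<Rightarrow> nat \<Rightarrow> 'a \<Rightarrow> nat" where
  "N2 U T \<omega> = T - (\<Sum>l=1..T. of_bool (U l \<omega>)) + 1"

definition PFS_RS ::
  "'a measure \<Rightarrow> (nat \<Rightarrow> nat \<Rightarrow> 'a \<Rightarrow> real) \<Rightarrow> (nat \<Rightarrow> 'a \<Rightarrow> bool) \<Rightarrow> nat \<Rightarrow> real" where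
  "PFS_RS M X U T =
     measure M {\<omega> \<in> space M. sample_mean X 1 (N1 U T \<omega>) \<omega> < sample_mean X 2 (N2 U T \<omega>) \<omega>}"

text \<open>The convention \<open>0 log 0 = 0\<close> holds here because the factor 0 annihilates the logarithm.\<close>

definition kl :: "real \<Rightarrow> real \<Rightarrow> real" where
  "kl \<alpha> p = \<alpha> * ln (\<alpha> / p) + (1 - \<alpha>) * ln ((1 - \<alpha>) / (1 - p))"

text \<open>
  The case distinction is needed: with \<open>x / 0 = 0\<close> the quotient alone would be positive at
  \<open>\<alpha> = 0\<close> and \<open>\<alpha> = 1\<close>, where the intended value is its limit 0.
\<close>

definition gaussian_rate :: "real \<Rightarrow> real \<Rightarrow> real \<Rightarrow> real \<Rightarrow> real" where
  "gaussian_rate \<delta> s1 s2 \<alpha> =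
     (if \<alpha> = 0 \<or> \<alpha> = 1 then 0
      else \<delta>\<^sup>2 / (2 * (s1\<^sup>2 / \<alpha> + s2\<^sup>2 / (1 - \<alpha>))))"

end

theory Submission
  imports Defs "HOL-Real_Asymp.Real_Asymp"
begin

text \<open>
  The allocation is independent of the samples. Conditioning on the number \<open>k\<close> of times that
  design 1 is chosen therefore turns the probability of false selection into a binomial mixture:
  its \<open>k\<close>-th term is the probability that a binomial variable with parameters \<open>T\<close> and \<open>p\<close> equals
  \<open>k\<close>, times the probability that a normal variable with mean \<open>-\<delta>\<close> and variance
  \<open>\<sigma>\<^sub>1\<^sup>2 / (k + 1) + \<sigma>\<^sub>2\<^sup>2 / (T - k + 1)\<close> is positive.

  Both factors are known up to subexponential terms. The binomial factor is \<open>exp (- T kl(k/T, p))\<close>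
  up to the factor \<open>T + 1\<close>: after a change of parameter from \<open>p\<close> to \<open>k/T\<close>, the value \<open>k\<close> is the
  mode of a binomial distribution with \<open>T + 1\<close> possible values. The Gaussian factor is
  \<open>exp (- T G(k/T))\<close>, where \<open>G\<close> is the Gaussian rate, up to corrections of order \<open>sqrt T\<close> in the
  exponent. So each of the \<open>T + 1\<close> terms behaves like \<open>exp (- T f(k/T))\<close> for the
  objective \<open>f = G + kl\<close>, and the largest term decides the decay of the sum (Laplace's
  principle).

  For the upper bound on the probability, every term is at most \<open>exp (- T inf f)\<close>, because the
  extra sample per design only decreases the variance. For the lower bound, \<open>f\<close> is
  continuous on \<open>[0, 1]\<close>, hence attains its infimum at some \<open>a\<close>, and the single term
  \<open>k = floor (a T)\<close> suffices, since \<open>k/T\<close> tends to \<open>a\<close>. Minimizers at the endpoints need no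
  separate treatment: the extra samples keep the variance finite, and as a function of both
  proportions \<open>u\<close> and \<open>v\<close> the Gaussian rate \<open>\<delta>\<^sup>2/2 * (u v / (\<sigma>\<^sub>1\<^sup>2 v + \<sigma>\<^sub>2\<^sup>2 u))\<close> is continuous there.
\<close>

section \<open>Binomial probabilities and the Kullback-Leibler divergence\<close>

text \<open>
  The numbers \<open>(n choose j) * k ^ j * (n - k) ^ (n - j)\<close> are \<open>n ^ n\<close> times the binomial
  probabilities with success parameter \<open>k/n\<close>. Working with these integers avoids divisions by
  zero at \<open>k = 0\<close> and \<open>k = n\<close>.
\<close>

lemma binomial_weight_ratio:
  fixes k n j :: nat
  assumes "j < n"
  shows "(n choose Suc j) * k ^ Suc j * (n - k) ^ (n - Suc j) * (Suc j * (n - k))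
       = (n choose j) * k ^ j * (n - k) ^ (n - j) * ((n - j) * k)"
proof -
  have 1: "(n - k) ^ (n - j) = (n - k) * (n - k) ^ (n - Suc j)"
    using assms by (metis Suc_diff_Suc power_Suc)
  have 2: "Suc j * (n choose Suc j) = (n - j) * (n choose j)"
    using binomial_absorb_comp[of n j] binomial_absorption[of j n] by simp
  have "(n choose Suc j) * k ^ Suc j * (n - k) ^ (n - Suc j) * (Suc j * (n - k))
      = (Suc j * (n choose Suc j)) * (k ^ Suc j * (n - k) ^ (n - Suc j) * (n - k))"
    by (simp only: mult_ac)
  also have "\<dots> = (n choose j) * k ^ j * (n - k) ^ (n - j) * ((n - j) * k)"
    unfolding 1 2 by (simp only: mult_ac power_Suc)
  finally show ?thesis .
qed

text \<open>
  The mode of the binomial distribution with parameters \<open>n\<close> and \<open>k/n\<close> is its mean \<open>k\<close>: for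
  \<open>k < n\<close> the weights increase up to \<open>k\<close> and decrease from \<open>k\<close> on, and for \<open>k = n\<close> only the
  weight of \<open>n\<close> can be nonzero.
\<close>
lemma binomial_weight_mode:
  fixes k n j :: nat
  assumes "j \<le> n" "k \<le> n"
  shows "(n choose j) * k ^ j * (n - k) ^ (n - j) \<le> (n choose k) * k ^ k * (n - k) ^ (n - k)"
proof (cases "k = n")
  case True
  then show ?thesis using assms by (cases "j = n") (auto simp: power_0_left)
next
  case False
  define w where "w j = (n choose j) * k ^ j * (n - k) ^ (n - j)" for j
  from False assms have kn: "k < n" by simp
  have ratio: "w (Suc i) * (Suc i * (n - k)) = w i * ((n - i) * k)" if "i < n" for i
    unfolding w_def using binomial_weight_ratio[OF that] .
  have up: "w i \<le> w (Suc i)" if "i < k" for i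
  proof -
    have "Suc i * (n - k) \<le> (n - i) * k"
      using that kn mult_mono[of "Suc i" k "n - k" "n - i"] by (simp add: mult.commute)
    then have "w i * (Suc i * (n - k)) \<le> w (Suc i) * (Suc i * (n - k))"
      using ratio[of i] that kn by simp
    then show ?thesis using kn by (simp only: mult_le_cancel2) simp
  qed
  have down: "w (Suc i) \<le> w i" if "k \<le> i" "i < n" for i
  proof -
    have "(n - i) * k \<le> Suc i * (n - k)"
      using that kn mult_mono[of "n - i" "n - k" k "Suc i"] by (simp add: mult.commute)
    then have "w (Suc i) * (Suc i * (n - k)) \<le> w i * (Suc i * (n - k))"
      using ratio[of i] that kn by simp
    then show ?thesis using kn by (simp only: mult_le_cancel2) simp
  qed
  have "w j \<le> w k"
  proof (cases "j \<le> k")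
    case True
    then show ?thesis
      by (induction rule: inc_induct) (auto intro: order_trans up)
  next
    case False
    then have "k \<le> j" by simp
    then show ?thesis using \<open>j \<le> n\<close>
    proof (induction rule: dec_induct)
      case (step i)
      then show ?case using down[of i] by simp
    qed simp
  qed
  then show ?thesis unfolding w_def .
qed

text \<open>
  The \<open>n + 1\<close> weights add up to \<open>n ^ n\<close>, so the largest one is at least their average.
\<close>
lemma binomial_weight_bounds:
  fixes k n :: nat
  assumes "k \<le> n"
  shows "(n choose k) * k ^ k * (n - k) ^ (n - k) \<le> n ^ n"
    and "n ^ n \<le> (n + 1) * ((n choose k) * k ^ k * (n - k) ^ (n - k))"
proof -
  define w where "w j = (n choose j) * k ^ j * (n - k) ^ (n - j)" for j
  have total: "n ^ n = (\<Sum>j\<le>n. w j)"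
    using binomial[of k "n - k" n] assms by (simp add: w_def)
  show "(n choose k) * k ^ k * (n - k) ^ (n - k) \<le> n ^ n"
    unfolding total w_def[symmetric] using assms by (intro member_le_sum) auto
  have "(\<Sum>j\<le>n. w j) \<le> (\<Sum>j\<le>n. w k)"
    unfolding w_def using assms by (intro sum_mono binomial_weight_mode) auto
  then show "n ^ n \<le> (n + 1) * ((n choose k) * k ^ k * (n - k) ^ (n - k))"
    unfolding total w_def[symmetric] by simp
qed

text \<open>
  With \<open>0 ^ 0 = 1\<close> on the left and the factor \<open>m\<close> in the exponent, \<open>m = 0\<close> is
  covered, which is the convention \<open>0 log 0 = 0\<close>.
\<close>
lemma self_power_times_exp_log_ratio:
  fixes m n :: nat and q :: real
  assumes "0 < n" "0 < q"
  shows "real m ^ m * exp (- (real m * ln (real m / real n / q))) = (real n * q) ^ m"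
proof (cases "m = 0")
  case False
  have "exp (- (real m * ln (real m / real n / q))) = inverse ((real m / real n / q) ^ m)"
    using False assms by (simp add: exp_minus exp_of_nat_mult)
  then show ?thesis
    using False assms by (simp add: field_simps)
qed simp

text \<open>
  Changing the success parameter of a binomial distribution from \<open>k/n\<close> to \<open>p\<close> multiplies the
  probability of \<open>k\<close> successes by exactly \<open>exp (- n kl(k/n, p))\<close>.
\<close>
lemma binomial_prob_eq_kl:
  fixes k n :: nat and p :: real
  assumes "k \<le> n" "0 < n" "0 < p" "p < 1"
  shows "real (n choose k) * p ^ k * (1 - p) ^ (n - k) * real n ^ n
       = real ((n choose k) * k ^ k * (n - k) ^ (n - k)) * exp (- (real n * kl (real k / real n) p))"
proof -
  have "1 - real k / real n = real (n - k) / real n"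
    using assms by (simp add: of_nat_diff field_simps)
  then have "real n * kl (real k / real n) p
      = real k * ln (real k / real n / p) + real (n - k) * ln (real (n - k) / real n / (1 - p))"
    using assms unfolding kl_def by (simp add: distrib_left del: of_nat_diff)
  then have "exp (- (real n * kl (real k / real n) p))
      = exp (- (real k * ln (real k / real n / p)))
        * exp (- (real (n - k) * ln (real (n - k) / real n / (1 - p))))"
    by (simp only: minus_add_distrib exp_add)
  then have "real ((n choose k) * k ^ k * (n - k) ^ (n - k)) * exp (- (real n * kl (real k / real n) p))
      = real (n choose k) * (real k ^ k * exp (- (real k * ln (real k / real n / p))))
        * (real (n - k) ^ (n - k) * exp (- (real (n - k) * ln (real (n - k) / real n / (1 - p)))))"
    by (simp only: of_nat_mult of_nat_power mult_ac)
  also have "\<dots> = real (n choose k) * (real n * p) ^ k * (real n * (1 - p)) ^ (n - k)"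
    using assms by (simp only: self_power_times_exp_log_ratio diff_gt_0_iff_gt)
  also have "\<dots> = real (n choose k) * p ^ k * (1 - p) ^ (n - k) * (real n ^ k * real n ^ (n - k))"
    by (simp only: power_mult_distrib mult_ac)
  also have "real n ^ k * real n ^ (n - k) = real n ^ n"
    using assms by (simp flip: power_add)
  finally show ?thesis by (rule sym)
qed

lemma binomial_prob_kl_bounds:
  fixes k n :: nat and p :: real
  assumes "k \<le> n" "0 < n" "0 < p" "p < 1"
  defines "b \<equiv> real (n choose k) * p ^ k * (1 - p) ^ (n - k)"
  shows "b \<le> exp (- (real n * kl (real k / real n) p))"
    and "exp (- (real n * kl (real k / real n) p)) / (real n + 1) \<le> b"
proof -
  define w where "w = real ((n choose k) * k ^ k * (n - k) ^ (n - k))"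
  define e where "e = exp (- (real n * kl (real k / real n) p))"
  have eq: "b * real n ^ n = w * e"
    unfolding b_def w_def e_def using assms by (intro binomial_prob_eq_kl)
  have pos: "0 < real n ^ n" "0 < e" using assms by (auto simp: e_def)
  have "w \<le> real n ^ n"
    using binomial_weight_bounds(1)[OF \<open>k \<le> n\<close>] unfolding w_def
    by (simp only: of_nat_le_iff flip: of_nat_power)
  then have "b * real n ^ n \<le> e * real n ^ n"
    unfolding eq using pos by simp
  then show "b \<le> exp (- (real n * kl (real k / real n) p))"
    using pos unfolding e_def[symmetric] by simp
  have "real (n ^ n) \<le> real ((n + 1) * ((n choose k) * k ^ k * (n - k) ^ (n - k)))"
    using binomial_weight_bounds(2)[OF \<open>k \<le> n\<close>] by (simp only: of_nat_le_iff)
  then have "real n ^ n \<le> (real n + 1) * w"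
    unfolding w_def by (simp only: of_nat_mult of_nat_add of_nat_power of_nat_1)
  then have "e * real n ^ n \<le> ((real n + 1) * w) * e"
    using pos by simp
  also have "\<dots> = (real n + 1) * b * real n ^ n"
    using eq by simp
  finally have "e \<le> (real n + 1) * b"
    using pos by (simp only: mult_le_cancel_right_pos)
  then show "exp (- (real n * kl (real k / real n) p)) / (real n + 1) \<le> b"
    unfolding e_def[symmetric] by (simp add: pos_divide_le_eq mult.commute)
qed

section \<open>The rate function and its minimizer\<close>

text \<open>
  Clearing the inner fractions makes the two exceptional values at \<open>0\<close> and \<open>1\<close> instances of one
  formula whose denominator never vanishes; this gives the continuity on \<open>[0, 1]\<close>.
\<close>
lemma gaussian_rate_fraction:
  assumes "0 < s1" "0 < s2" "0 \<le> a" "a \<le> 1"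
  shows "gaussian_rate \<delta> s1 s2 a = \<delta>\<^sup>2 / 2 * (a * (1 - a) / (s1\<^sup>2 * (1 - a) + s2\<^sup>2 * a))"
proof (cases "a = 0 \<or> a = 1")
  case False
  then have "0 < a" "0 < 1 - a" using assms by auto
  then have "s1\<^sup>2 / a + s2\<^sup>2 / (1 - a) = (s1\<^sup>2 * (1 - a) + s2\<^sup>2 * a) / (a * (1 - a))"
    by (simp add: add_divide_distrib)
  then show ?thesis using False by (simp add: gaussian_rate_def)
qed (auto simp: gaussian_rate_def)

lemma gaussian_rate_denominator_pos:
  fixes s1 s2 a :: real
  assumes "0 < s1" "0 < s2" "0 \<le> a" "a \<le> 1"
  shows "0 < s1\<^sup>2 * (1 - a) + s2\<^sup>2 * a"
proof (cases "a = 0")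
  case False
  then show ?thesis using assms by (intro add_nonneg_pos) auto
qed (use assms in auto)

lemma continuous_on_gaussian_rate:
  assumes "0 < s1" "0 < s2"
  shows "continuous_on {0..1} (gaussian_rate \<delta> s1 s2)"
proof -
  have "s1\<^sup>2 * (1 - a) + s2\<^sup>2 * a \<noteq> 0" if "a \<in> {0..1}" for a
    using gaussian_rate_denominator_pos[of s1 s2 a] assms that by auto
  then have "continuous_on {0..1}
      (\<lambda>a. \<delta>\<^sup>2 / 2 * (a * (1 - a) / (s1\<^sup>2 * (1 - a) + s2\<^sup>2 * a)))"
    by (intro continuous_intros) auto
  then show ?thesis
    using assms by (subst continuous_on_cong[OF refl gaussian_rate_fraction]) auto
qed

lemma continuous_on_x_ln_x: "continuous_on {0..} (\<lambda>x::real. x * ln x)"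
proof -
  have "continuous (at x within {0..}) (\<lambda>x::real. x * ln x)" if "0 \<le> x" for x
  proof (cases "x = 0")
    case True
    have "((\<lambda>x::real. x * ln x) \<longlongrightarrow> 0) (at_right 0)"
      by real_asymp
    then show ?thesis
      unfolding True continuous_within by (simp add: at_within_Ici_at_right)
  next
    case False
    then show ?thesis using that by (intro continuous_intros) auto
  qed
  then show ?thesis by (auto simp: continuous_on_eq_continuous_within)
qed

lemma continuous_on_kl:
  assumes "0 < p" "p < 1"
  shows "continuous_on {0..1} (\<lambda>a. kl a p)"
proof -
  have eq: "kl a p = a * ln a - a * ln p + ((1 - a) * ln (1 - a) - (1 - a) * ln (1 - p))"
    if "a \<in> {0..1}" for a
    using that assms unfolding kl_def
    by (cases "a = 0"; cases "a = 1") (auto simp: ln_div algebra_simps)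
  have "continuous_on {0..1} (\<lambda>a::real. a * ln a)"
    using continuous_on_x_ln_x by (rule continuous_on_subset) auto
  moreover have "continuous_on {0..1} (\<lambda>a::real. (1 - a) * ln (1 - a))"
    by (rule continuous_on_compose2[OF continuous_on_x_ln_x]) (auto intro!: continuous_on_diff)
  ultimately have "continuous_on {0..1}
      (\<lambda>a. a * ln a - a * ln p + ((1 - a) * ln (1 - a) - (1 - a) * ln (1 - p)))"
    by (intro continuous_on_add continuous_on_diff continuous_on_mult_right continuous_on_id
        continuous_on_const)
  then show ?thesis
    by (subst continuous_on_cong[OF refl eq]) auto
qed

definition rate :: "real \<Rightarrow> real \<Rightarrow> real \<Rightarrow> real \<Rightarrow> real \<Rightarrow> real" where
  "rate \<delta> s1 s2 p \<alpha> = gaussian_rate \<delta> s1 s2 \<alpha> + kl \<alpha> p"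

lemma rate_minimizer:
  assumes "0 < s1" "0 < s2" "0 < p" "p < 1"
  obtains a where "a \<in> {0..1}" "(INF \<alpha>\<in>{0..1}. rate \<delta> s1 s2 p \<alpha>) = rate \<delta> s1 s2 p a"
    "\<And>b. b \<in> {0..1} \<Longrightarrow> rate \<delta> s1 s2 p a \<le> rate \<delta> s1 s2 p b"
proof -
  have "continuous_on {0..1} (rate \<delta> s1 s2 p)"
    unfolding rate_def[abs_def] using assms
    by (intro continuous_on_add continuous_on_gaussian_rate continuous_on_kl)
  then obtain a where a: "a \<in> {0..1}"
    and least: "\<And>b. b \<in> {0..1} \<Longrightarrow> rate \<delta> s1 s2 p a \<le> rate \<delta> s1 s2 p b"
    using continuous_attains_inf[of "{0..1::real}" "rate \<delta> s1 s2 p"] by auto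
  have "(INF \<alpha>\<in>{0..1}. rate \<delta> s1 s2 p \<alpha>) = rate \<delta> s1 s2 p a"
    using a least by (intro cInf_eq_minimum) auto
  with a least show ?thesis using that by blast
qed

section \<open>Gaussian tails\<close>

text \<open>
  Upper bound: for \<open>x > 0\<close> the density at \<open>x\<close> of the normal law with mean \<open>-d\<close> is at most
  \<open>exp (- d\<^sup>2 / (2 s\<^sup>2))\<close> times that of the centred one, which integrates to 1. Lower bound: on
  \<open>{0<..s}\<close> the density is at least its value at \<open>s\<close>, and the interval has length \<open>s\<close>. The loss
  is a replacement of \<open>d / s\<close> by \<open>1 + d / s\<close> and a constant, which does not affect exponential rates.
\<close>
lemma normal_upper_tail_bounds:
  fixes d s :: real
  assumes "prob_space M" and D: "distributed M lborel D (normal_density (- d) s)"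
    and "0 < d" "0 < s"
  shows "measure M {\<omega> \<in> space M. 0 < D \<omega>} \<le> exp (- (d\<^sup>2 / (2 * s\<^sup>2)))"
    and "exp (- ((1 + d / s)\<^sup>2 / 2)) / sqrt (2 * pi) \<le> measure M {\<omega> \<in> space M. 0 < D \<omega>}"
proof -
  interpret prob_space M by fact
  have ev: "{\<omega> \<in> space M. 0 < D \<omega>} = D -` {0<..} \<inter> space M" by auto
  have em: "ennreal (measure M {\<omega> \<in> space M. 0 < D \<omega>})
      = (\<integral>\<^sup>+ x. ennreal (normal_density (- d) s x) * indicator {0<..} x \<partial>lborel)"
    unfolding ev using distributed_emeasure[OF D, of "{0<..}"] by (simp add: emeasure_eq_measure)
  have pw: "normal_density (- d) s x \<le> exp (- (d\<^sup>2 / (2 * s\<^sup>2))) * normal_density 0 s x"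
    if "0 < x" for x
  proof -
    have "- ((x + d)\<^sup>2) / (2 * s\<^sup>2) \<le> - (d\<^sup>2 / (2 * s\<^sup>2)) + (- (x\<^sup>2) / (2 * s\<^sup>2))"
      using that assms by (simp add: field_simps power2_eq_square)
    then have "exp (- ((x + d)\<^sup>2) / (2 * s\<^sup>2)) \<le> exp (- (d\<^sup>2 / (2 * s\<^sup>2))) * exp (- (x\<^sup>2) / (2 * s\<^sup>2))"
      by (simp only: exp_add[symmetric] exp_le_cancel_iff)
    then show ?thesis
      unfolding normal_density_def by (simp add: divide_right_mono)
  qed
  have "ennreal (measure M {\<omega> \<in> space M. 0 < D \<omega>})
      \<le> (\<integral>\<^sup>+ x. ennreal (exp (- (d\<^sup>2 / (2 * s\<^sup>2)))) * ennreal (normal_density 0 s x) \<partial>lborel)"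
    unfolding em by (intro nn_integral_mono)
      (auto simp: indicator_def pw ennreal_mult[symmetric] intro!: ennreal_leI)
  also have "\<dots> = ennreal (exp (- (d\<^sup>2 / (2 * s\<^sup>2))))"
    using \<open>0 < s\<close> by (simp add: nn_integral_cmult nn_integral_eq_integral normal_density_nonneg)
  finally show "measure M {\<omega> \<in> space M. 0 < D \<omega>} \<le> exp (- (d\<^sup>2 / (2 * s\<^sup>2)))"
    by simp
  define c where "c = exp (- ((1 + d / s)\<^sup>2 / 2)) / (sqrt (2 * pi) * s)"
  have pw2: "c \<le> normal_density (- d) s x" if "0 < x" "x \<le> s" for x
  proof -
    have "(x + d)\<^sup>2 \<le> (s + d)\<^sup>2" using that assms by (intro power_mono) auto
    moreover have "(1 + d / s)\<^sup>2 / 2 = (s + d)\<^sup>2 / (2 * s\<^sup>2)"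
      using assms by (simp add: field_simps power2_eq_square)
    ultimately have "- ((1 + d / s)\<^sup>2 / 2) \<le> - ((x + d)\<^sup>2) / (2 * s\<^sup>2)"
      using divide_right_mono[of "(x + d)\<^sup>2" "(s + d)\<^sup>2" "2 * s\<^sup>2"] by simp
    then have "exp (- ((1 + d / s)\<^sup>2 / 2)) \<le> exp (- ((x + d)\<^sup>2) / (2 * s\<^sup>2))"
      by simp
    moreover have "sqrt (2 * pi * s\<^sup>2) = sqrt (2 * pi) * s"
      using \<open>0 < s\<close> by (simp only: real_sqrt_mult real_sqrt_abs abs_of_pos)
    ultimately show ?thesis
      using \<open>0 < s\<close> unfolding c_def normal_density_def by (simp add: divide_right_mono)
  qed
  have "ennreal (c * s) = (\<integral>\<^sup>+ x. ennreal c * indicator {0<..s} x \<partial>lborel)"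
    using \<open>0 < s\<close> by (simp add: nn_integral_cmult_indicator flip: ennreal_mult'')
  also have "\<dots> \<le> (\<integral>\<^sup>+ x. ennreal (normal_density (- d) s x) * indicator {0<..} x \<partial>lborel)"
    by (intro nn_integral_mono) (auto split: split_indicator intro!: ennreal_leI pw2)
  finally have "c * s \<le> measure M {\<omega> \<in> space M. 0 < D \<omega>}"
    unfolding em[symmetric] by (subst (asm) ennreal_le_iff) auto
  then show "exp (- ((1 + d / s)\<^sup>2 / 2)) / sqrt (2 * pi) \<le> measure M {\<omega> \<in> space M. 0 < D \<omega>}"
    using assms by (simp add: c_def)
qed

section \<open>Conditioning on the number of allocations\<close>

context two_design_rs
begin

text \<open>
  All samples and randomizations as one family, so that the joint independence can be used for
  blocks of its index set.
\<close>
definition obs :: "nat \<times> nat + nat \<Rightarrow> 'a \<Rightarrow> real" where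
  "obs k \<omega> = (case k of Inl (i, r) \<Rightarrow> X i r \<omega> | Inr l \<Rightarrow> of_bool (U l \<omega>))"

lemma indep_obs: "indep_vars (\<lambda>_. borel) obs (({1, 2} \<times> {1..}) <+> {1..})"
  using indep unfolding obs_def .

lemma measurable_obs: "k \<in> ({1, 2} \<times> {1..}) <+> {1..} \<Longrightarrow> obs k \<in> borel_measurable M"
  using indep_obs unfolding indep_vars_def by blast

lemma obs_U_event:
  "obs (Inr l) -` {of_bool b} \<inter> space M = {\<omega> \<in> space M. U l \<omega> = b}"
  unfolding obs_def by (cases b) auto

lemma sets_U_event:
  assumes "1 \<le> l"
  shows "{\<omega> \<in> space M. U l \<omega>} \<in> sets M"
proof -
  have "obs (Inr l) -` {of_bool True} \<inter> space M \<in> sets M"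
    using measurable_obs[of "Inr l"] assms by (intro measurable_sets[of _ _ borel]) auto
  then show ?thesis unfolding obs_U_event by simp
qed

lemma prob_U:
  assumes "1 \<le> l" "0 \<le> p" "p \<le> 1"
  shows "prob (obs (Inr l) -` {of_bool b} \<inter> space M) = (if b then p else 1 - p)"
proof -
  have "measure (distr M (count_space UNIV) (U l)) {b} = (if b then p else 1 - p)"
    unfolding U_distr[OF \<open>1 \<le> l\<close>] using assms by (simp add: measure_pmf_single)
  moreover have "measure (distr M (count_space UNIV) (U l)) {b} = prob (U l -` {b} \<inter> space M)"
  proof (rule measure_distr)
    show "U l \<in> measurable M (count_space UNIV)"
      using sets_U_event[OF \<open>1 \<le> l\<close>] by (simp add: pred_def)
  qed simp
  moreover have "U l -` {b} \<inter> space M = obs (Inr l) -` {of_bool b} \<inter> space M"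
    unfolding obs_U_event by auto
  ultimately show ?thesis by simp
qed

definition choices :: "nat \<Rightarrow> 'a \<Rightarrow> nat set" where
  "choices T \<omega> = {l\<in>{1..T}. U l \<omega>}"

lemma prob_choices:
  assumes "A \<subseteq> {1..T}" "0 \<le> p" "p \<le> 1"
  shows "prob {\<omega> \<in> space M. choices T \<omega> = A} = p ^ card A * (1 - p) ^ (T - card A)"
proof (cases "T = 0")
  case True
  then show ?thesis using assms by (simp add: choices_def prob_space)
next
  case False
  then have T_in: "T \<in> {1..T}" by simp
  have fin: "finite A" using assms finite_subset by blast
  have "{\<omega> \<in> space M. choices T \<omega> = A} = (\<Inter>l\<in>{1..T}. {\<omega> \<in> space M. U l \<omega> = (l \<in> A)})"
    using assms T_in unfolding choices_def by blast
  also have "\<dots> = (\<Inter>k\<in>Inr ` {1..T}. obs k -` {of_bool (k \<in> Inr ` A)} \<inter> space M)"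
    by (simp only: image_image obs_U_event inj_image_mem_iff inj_Inr)
  also have "prob \<dots> = (\<Prod>k\<in>Inr ` {1..T}. prob (obs k -` {of_bool (k \<in> Inr ` A)} \<inter> space M))"
    using False by (intro indep_varsD[OF indep_obs]) auto
  also have "\<dots> = (\<Prod>l\<in>{1..T}. if l \<in> A then p else 1 - p)"
    using assms by (subst prod.reindex) (auto simp: prob_U inj_image_mem_iff intro!: prod.cong)
  also have "\<dots> = (\<Prod>l\<in>A. p) * (\<Prod>l\<in>{1..T} - A. 1 - p)"
  proof -
    have "{1..T} \<inter> {l. l \<in> A} = A" "{1..T} \<inter> - {l. l \<in> A} = {1..T} - A" using assms by auto
    then show ?thesis by (subst prod.If_cases) (simp_all only: finite_atLeastAtMost)
  qed
  also have "\<dots> = p ^ card A * (1 - p) ^ (T - card A)"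
    using assms fin by (simp add: card_Diff_subset)
  finally show ?thesis .
qed

definition pulls :: "nat \<Rightarrow> 'a \<Rightarrow> nat" where
  "pulls T \<omega> = (\<Sum>l=1..T. of_bool (U l \<omega>))"

lemma pulls_eq_card: "pulls T \<omega> = card (choices T \<omega>)"
  unfolding pulls_def choices_def by (simp add: sum.If_cases of_bool_def Int_def)

lemma pulls_le: "pulls T \<omega> \<le> T"
proof -
  have "choices T \<omega> \<subseteq> {1..T}" by (auto simp: choices_def)
  from card_mono[OF _ this] show ?thesis by (simp add: pulls_eq_card)
qed

lemma sets_choices_event: "{\<omega> \<in> space M. choices T \<omega> = A} \<in> sets M"
proof (cases "A \<subseteq> {1..T}")
  case True
  then have "{\<omega> \<in> space M. choices T \<omega> = A} = {\<omega> \<in> space M. \<forall>l\<in>{1..T}. U l \<omega> = (l \<in> A)}"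
    unfolding choices_def by auto
  also have "\<dots> \<in> sets M"
  proof (intro sets.sets_Collect_finite_All)
    fix l assume "l \<in> {1..T}"
    then have "{\<omega> \<in> space M. U l \<omega>} \<in> sets M" by (intro sets_U_event) auto
    moreover from this have "{\<omega> \<in> space M. \<not> U l \<omega>} \<in> sets M"
      by (rule sets.sets_Collect_neg)
    ultimately show "{\<omega> \<in> space M. U l \<omega> = (l \<in> A)} \<in> sets M"
      by (cases "l \<in> A") simp_all
  qed simp
  finally show ?thesis .
next
  case False
  then have "{\<omega> \<in> space M. choices T \<omega> = A} = {}"
    unfolding choices_def by auto
  then show ?thesis by (simp only: sets.empty_sets)
qed

lemma pulls_event:
  "{\<omega> \<in> space M. pulls T \<omega> = k}
   = (\<Union>A\<in>{A. A \<subseteq> {1..T} \<and> card A = k}. {\<omega> \<in> space M. choices T \<omega> = A})"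
  unfolding pulls_eq_card by (auto simp: choices_def)

lemma sets_pulls_event: "{\<omega> \<in> space M. pulls T \<omega> = k} \<in> sets M"
  unfolding pulls_event using sets_choices_event by (intro sets.finite_UN) auto

lemma prob_pulls:
  assumes "0 \<le> p" "p \<le> 1"
  shows "prob {\<omega> \<in> space M. pulls T \<omega> = k} = real (T choose k) * p ^ k * (1 - p) ^ (T - k)"
proof -
  let ?S = "{A. A \<subseteq> {1..T} \<and> card A = k}"
  have "prob {\<omega> \<in> space M. pulls T \<omega> = k} = (\<Sum>A\<in>?S. prob {\<omega> \<in> space M. choices T \<omega> = A})"
    unfolding pulls_event using sets_choices_event
    by (intro finite_measure_finite_Union) (auto simp: disjoint_family_on_def)
  also have "\<dots> = (\<Sum>A\<in>?S. p ^ k * (1 - p) ^ (T - k))"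
    using assms by (intro sum.cong) (auto simp: prob_choices)
  also have "\<dots> = real (T choose k) * p ^ k * (1 - p) ^ (T - k)"
    by (simp add: n_subsets)
  finally show ?thesis .
qed

definition gap :: "nat \<Rightarrow> nat \<Rightarrow> 'a \<Rightarrow> real" where
  "gap m n \<omega> = sample_mean X 2 n \<omega> - sample_mean X 1 m \<omega>"

definition block :: "nat \<Rightarrow> nat \<Rightarrow> (nat \<times> nat + nat) set" where
  "block m n = Inl ` ({1} \<times> {1..m} \<union> {2} \<times> {1..n})"

definition coef :: "nat \<Rightarrow> nat \<Rightarrow> nat \<times> nat + nat \<Rightarrow> real" where
  "coef m n k = (case k of Inl (i, r) \<Rightarrow> if i = 1 then - 1 / real m else 1 / real n | Inr l \<Rightarrow> 0)"

lemma sum_block: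
  fixes f :: "_ \<Rightarrow> real"
  shows "(\<Sum>k\<in>block m n. f k) = (\<Sum>r=1..m. f (Inl (1, r))) + (\<Sum>r=1..n. f (Inl (2, r)))"
proof -
  have P: "{i} \<times> {1..l} = Pair i ` {1..l}" for i l :: nat by auto
  have "(\<Sum>k\<in>block m n. f k) = (\<Sum>x\<in>{1} \<times> {1..m} \<union> {2} \<times> {1..n}. f (Inl x))"
    unfolding block_def by (simp add: sum.reindex)
  also have "\<dots> = (\<Sum>x\<in>{1} \<times> {1..m}. f (Inl x)) + (\<Sum>x\<in>{2} \<times> {1..n}. f (Inl x))"
    by (intro sum.union_disjoint) auto
  also have "\<dots> = (\<Sum>r=1..m. f (Inl (1, r))) + (\<Sum>r=1..n. f (Inl (2, r)))"
    unfolding P by (simp add: sum.reindex inj_on_def)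
  finally show ?thesis .
qed

text \<open>
  Writing the difference of the sample means as one weighted sum over independent observations
  gives its normal law from a single application of the addition theorem for normal variables.
\<close>
lemma gap_eq_sum_block: "gap m n \<omega> = (\<Sum>k\<in>block m n. coef m n k * obs k \<omega>)"
  unfolding sum_block gap_def sample_mean_def coef_def obs_def
  by (simp add: sum_divide_distrib sum_negf)

lemma distributed_gap:
  assumes "0 < m" "0 < n" "0 < \<sigma> 1" "0 < \<sigma> 2"
  shows "distributed M lborel (gap m n)
     (normal_density (\<mu> 2 - \<mu> 1) (sqrt ((\<sigma> 1)\<^sup>2 / real m + (\<sigma> 2)\<^sup>2 / real n)))"
proof -
  define \<nu> where "\<nu> k = (case k of Inl (i, r) \<Rightarrow> \<mu> i | Inr l \<Rightarrow> 0)" for k :: "nat \<times> nat + nat"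
  define \<tau> where "\<tau> k = (case k of Inl (i, r) \<Rightarrow> \<sigma> i | Inr l \<Rightarrow> 0)" for k :: "nat \<times> nat + nat"
  let ?c = "coef m n"
  have sub: "block m n \<subseteq> ({1, 2} \<times> {1..}) <+> {1..}" by (auto simp: block_def)
  have pos: "0 < \<bar>?c k\<bar> * \<tau> k" if "k \<in> block m n" for k
    using that assms by (auto simp: block_def \<tau>_def coef_def)
  have norm: "distributed M lborel (\<lambda>\<omega>. ?c k * obs k \<omega>) (normal_density (?c k * \<nu> k) (\<bar>?c k\<bar> * \<tau> k))"
    if k: "k \<in> block m n" for k
  proof -
    have "distributed M lborel (obs k) (normal_density (\<nu> k) (\<tau> k))"
      using k sample_distr by (auto simp: block_def \<nu>_def \<tau>_def obs_def[abs_def])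
    then have "distributed M lborel (\<lambda>\<omega>. 0 + ?c k * obs k \<omega>)
        (normal_density (0 + ?c k * \<nu> k) (\<bar>?c k\<bar> * \<tau> k))"
      using pos[OF k] by (intro normal_density_affine) (auto simp: zero_less_mult_iff)
    then show ?thesis by simp
  qed
  have "distributed M lborel (\<lambda>\<omega>. \<Sum>k\<in>block m n. ?c k * obs k \<omega>)
      (normal_density (\<Sum>k\<in>block m n. ?c k * \<nu> k) (sqrt (\<Sum>k\<in>block m n. (\<bar>?c k\<bar> * \<tau> k)\<^sup>2)))"
  proof (rule sum_indep_normal)
    show "finite (block m n)" "block m n \<noteq> {}" using assms by (auto simp: block_def)
    show "indep_vars (\<lambda>_. borel) (\<lambda>k \<omega>. ?c k * obs k \<omega>) (block m n)"
      using indep_vars_compose2[OF indep_vars_subset[OF indep_obs sub],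
          of "\<lambda>k x. ?c k * x" "\<lambda>_. borel"] by simp
  qed (use pos norm in auto)
  moreover have "(\<Sum>k\<in>block m n. ?c k * \<nu> k) = \<mu> 2 - \<mu> 1"
    unfolding sum_block using assms by (simp add: coef_def \<nu>_def)
  moreover have "(\<Sum>k\<in>block m n. (\<bar>?c k\<bar> * \<tau> k)\<^sup>2) = (\<sigma> 1)\<^sup>2 / real m + (\<sigma> 2)\<^sup>2 / real n"
    unfolding sum_block using assms
    by (simp add: coef_def \<tau>_def power_mult_distrib power_divide) (simp add: power2_eq_square)
  ultimately show ?thesis by (simp add: gap_eq_sum_block[abs_def])
qed

text \<open>
  The numbers \<open>m\<close> and \<open>n\<close> of samples are fixed here. The two events then
  depend on disjoint blocks of the independent family.
\<close>
lemma prob_pulls_and_gap: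
  "prob {\<omega> \<in> space M. pulls T \<omega> = k \<and> 0 < gap m n \<omega>}
   = prob {\<omega> \<in> space M. pulls T \<omega> = k} * prob {\<omega> \<in> space M. 0 < gap m n \<omega>}"
proof -
  let ?A = "Inr ` {1..T} :: (nat \<times> nat + nat) set" and ?B = "block m n"
  have iv: "indep_var (PiM ?A (\<lambda>_. borel)) (\<lambda>\<omega>. restrict (\<lambda>i. obs i \<omega>) ?A)
                (PiM ?B (\<lambda>_. borel)) (\<lambda>\<omega>. restrict (\<lambda>i. obs i \<omega>) ?B)"
    by (intro indep_var_restrict[OF indep_obs]) (auto simp: block_def)
  define f where "f z = (\<Sum>i\<in>?A. z i)" for z :: "_ \<Rightarrow> real"
  define g where "g z = (\<Sum>i\<in>?B. coef m n i * z i)" for z :: "_ \<Rightarrow> real"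
  have f: "f \<in> borel_measurable (PiM ?A (\<lambda>_. borel))"
    unfolding f_def by (intro borel_measurable_sum measurable_component_singleton)
  have g: "g \<in> borel_measurable (PiM ?B (\<lambda>_. borel))"
    unfolding g_def
    by (intro borel_measurable_sum borel_measurable_times measurable_component_singleton) auto
  have f_eq: "f (restrict (\<lambda>i. obs i \<omega>) ?A) = real (pulls T \<omega>)" for \<omega>
    by (simp add: f_def pulls_def sum.reindex obs_def)
  have g_eq: "g (restrict (\<lambda>i. obs i \<omega>) ?B) = gap m n \<omega>" for \<omega>
    by (simp add: g_def gap_eq_sum_block)
  have "indep_var borel (\<lambda>\<omega>. real (pulls T \<omega>)) borel (gap m n)"
    using indep_var_compose[OF iv f g] by (simp only: o_def f_eq g_eq)
  from indep_varD[OF this, of "{real k}" "{0<..}"]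
  have "prob ((\<lambda>\<omega>. (real (pulls T \<omega>), gap m n \<omega>)) -` ({real k} \<times> {0<..}) \<inter> space M)
      = prob ((\<lambda>\<omega>. real (pulls T \<omega>)) -` {real k} \<inter> space M) * prob (gap m n -` {0<..} \<inter> space M)"
    by simp
  moreover have "(\<lambda>\<omega>. (real (pulls T \<omega>), gap m n \<omega>)) -` ({real k} \<times> {0<..}) \<inter> space M
      = {\<omega> \<in> space M. pulls T \<omega> = k \<and> 0 < gap m n \<omega>}" by auto
  moreover have "(\<lambda>\<omega>. real (pulls T \<omega>)) -` {real k} \<inter> space M = {\<omega> \<in> space M. pulls T \<omega> = k}"
    by auto
  moreover have "gap m n -` {0<..} \<inter> space M = {\<omega> \<in> space M. 0 < gap m n \<omega>}" by auto
  ultimately show ?thesis by simp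
qed

text \<open>
  On the event that design 1 is chosen \<open>k\<close> times the random sample sizes are the constants
  \<open>k + 1\<close> and \<open>T - k + 1\<close>, so the independence for fixed sizes applies on each of these events.
\<close>
lemma PFS_RS_eq_mixture:
  assumes "0 \<le> p" "p \<le> 1" "0 < \<sigma> 1" "0 < \<sigma> 2"
  shows "PFS_RS M X U T = (\<Sum>k\<le>T. real (T choose k) * p ^ k * (1 - p) ^ (T - k)
           * prob {\<omega> \<in> space M. 0 < gap (k + 1) (T - k + 1) \<omega>})"
proof -
  have meas: "{\<omega> \<in> space M. pulls T \<omega> = k \<and> 0 < gap (k + 1) (T - k + 1) \<omega>} \<in> sets M" for k
  proof -
    have "gap (k + 1) (T - k + 1) \<in> borel_measurable M"
      using distributed_measurable[OF distributed_gap[of "k + 1" "T - k + 1"]] assms by simp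
    then have "{\<omega> \<in> space M. 0 < gap (k + 1) (T - k + 1) \<omega>} \<in> sets M"
      by measurable
    from this and sets_pulls_event show ?thesis by (rule sets.sets_Collect_conj)
  qed
  have "{\<omega> \<in> space M. sample_mean X 1 (N1 U T \<omega>) \<omega> < sample_mean X 2 (N2 U T \<omega>) \<omega>}
      = (\<Union>k\<le>T. {\<omega> \<in> space M. pulls T \<omega> = k \<and> 0 < gap (k + 1) (T - k + 1) \<omega>})"
    using pulls_le by (auto simp: N1_def N2_def pulls_def gap_def)
  then have "PFS_RS M X U T
      = (\<Sum>k\<le>T. prob {\<omega> \<in> space M. pulls T \<omega> = k \<and> 0 < gap (k + 1) (T - k + 1) \<omega>})"
    unfolding PFS_RS_def using meas
    by (simp only:) (intro finite_measure_finite_Union, auto simp: disjoint_family_on_def)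
  then show ?thesis
    using assms by (simp add: prob_pulls_and_gap prob_pulls)
qed

end

section \<open>Exponential order of the terms of the mixture\<close>

text \<open>
  The extra sample of each design only decreases the variance of the difference of the
  sample means; for \<open>0 < k < T\<close> the exponent without it would be exactly \<open>T\<close> times the Gaussian
  rate at \<open>k/T\<close>, and at \<open>k = 0\<close> and \<open>k = T\<close> that rate is 0.
\<close>
lemma gaussian_rate_le_exponent:
  fixes T k :: nat
  assumes "0 < s1" "0 < s2" "k \<le> T" "0 < T"
  shows "real T * gaussian_rate \<delta> s1 s2 (real k / real T)
       \<le> \<delta>\<^sup>2 / (2 * (s1\<^sup>2 / real (k + 1) + s2\<^sup>2 / real (T - k + 1)))"
proof (cases "k = 0 \<or> k = T")
  case True
  then show ?thesis using assms by (auto simp: gaussian_rate_def)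
next
  case False
  define x where "x = real k"
  define y where "y = real (T - k)"
  have xy: "0 < x" "0 < y" "real T = x + y"
    using False assms by (auto simp: x_def y_def of_nat_diff)
  have y_eq: "1 - x / (x + y) = y / (x + y)" using xy by (simp add: field_simps)
  have V: "0 < s1\<^sup>2 / (x + 1) + s2\<^sup>2 / (y + 1)"
    using assms xy by (intro add_pos_pos) auto
  have mono: "s1\<^sup>2 / (x + 1) + s2\<^sup>2 / (y + 1) \<le> s1\<^sup>2 / x + s2\<^sup>2 / y"
    using xy by (intro add_mono divide_left_mono) auto
  have "(x + y) * gaussian_rate \<delta> s1 s2 (x / (x + y))
      = (x + y) * (\<delta>\<^sup>2 / (2 * ((x + y) * (s1\<^sup>2 / x + s2\<^sup>2 / y))))"
    using xy unfolding gaussian_rate_def y_eq by (simp add: distrib_left mult.commute)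
  also have "\<dots> = \<delta>\<^sup>2 / (2 * (s1\<^sup>2 / x + s2\<^sup>2 / y))"
    using xy by simp
  also have "\<dots> \<le> \<delta>\<^sup>2 / (2 * (s1\<^sup>2 / (x + 1) + s2\<^sup>2 / (y + 1)))"
    using V mono by (intro divide_left_mono) auto
  finally show ?thesis
    using xy by (simp only: x_def y_def of_nat_add of_nat_1)
qed

lemma tendsto_floor_fraction:
  fixes a :: real
  assumes "0 \<le> a"
  shows "(\<lambda>T. real (nat \<lfloor>a * real T\<rfloor>) / real T) \<longlonglongrightarrow> a"
proof (rule tendsto_sandwich)
  have fl: "real (nat \<lfloor>a * real T\<rfloor>) = of_int \<lfloor>a * real T\<rfloor>" for T
    using assms by simp
  show "\<forall>\<^sub>F T in sequentially. a - 1 / real T \<le> real (nat \<lfloor>a * real T\<rfloor>) / real T"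
    using eventually_gt_at_top[of 0]
  proof eventually_elim
    case (elim T)
    have "a * real T - 1 \<le> of_int \<lfloor>a * real T\<rfloor>" by linarith
    then have "(a * real T - 1) / real T \<le> of_int \<lfloor>a * real T\<rfloor> / real T"
      by (rule divide_right_mono) simp
    then show ?case unfolding fl using elim by (simp add: diff_divide_distrib)
  qed
  show "\<forall>\<^sub>F T in sequentially. real (nat \<lfloor>a * real T\<rfloor>) / real T \<le> a"
    using eventually_gt_at_top[of 0]
  proof eventually_elim
    case (elim T)
    have "of_int \<lfloor>a * real T\<rfloor> \<le> a * real T" by linarith
    then show ?case unfolding fl using elim by (simp add: field_simps)
  qed
  show "(\<lambda>T. a - 1 / real T) \<longlonglongrightarrow> a" by real_asymp
qed simp

text \<open>
  The sequence is the exponent in the lower Gaussian tail bound, divided by \<open>T\<close>. In terms of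
  the proportions \<open>x = (K + 1)/T\<close> and \<open>y = (T - K + 1)/T\<close>, positive for \<open>T > 0\<close>, \<open>T\<close> times the
  variance is the reciprocal of \<open>q x y = x y / (s1\<^sup>2 y + s2\<^sup>2 x)\<close>. Since \<open>q\<close> is continuous at
  \<open>(a, 1 - a)\<close> also for \<open>a = 0\<close> and \<open>a = 1\<close>, the limit includes these endpoints.
\<close>
lemma tendsto_tail_exponent:
  fixes K :: "nat \<Rightarrow> nat"
  assumes "0 < s1" "0 < s2" "a \<in> {0..1}" "\<And>T. K T \<le> T"
    and frac: "(\<lambda>T. real (K T) / real T) \<longlonglongrightarrow> a" and "0 \<le> \<delta>"
  shows "(\<lambda>T. (1 / sqrt (real T) + \<delta> / sqrt (real T
              * (s1\<^sup>2 / real (K T + 1) + s2\<^sup>2 / real (T - K T + 1))))\<^sup>2 / 2)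
         \<longlonglongrightarrow> gaussian_rate \<delta> s1 s2 a"
proof -
  define x where "x T = real (K T + 1) / real T" for T
  define y where "y T = real (T - K T + 1) / real T" for T
  define q where "q u v = u * v / (s1\<^sup>2 * v + s2\<^sup>2 * u)" for u v
  have inv: "(\<lambda>T. 1 / real T) \<longlonglongrightarrow> 0" by real_asymp
  have "(\<lambda>T. real (K T) / real T + 1 / real T) \<longlonglongrightarrow> a + 0"
    by (intro tendsto_add frac inv)
  then have x: "x \<longlonglongrightarrow> a" by (simp add: x_def[abs_def] add_divide_distrib add.commute)
  have "(\<lambda>T. 1 - real (K T) / real T + 1 / real T) \<longlonglongrightarrow> 1 - a + 0"
    by (intro tendsto_intros frac inv)
  moreover have "\<forall>\<^sub>F T in sequentially. 1 - real (K T) / real T + 1 / real T = y T"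
    using eventually_gt_at_top[of 0]
  proof eventually_elim
    case (elim T)
    then show ?case using assms(4)[of T] by (simp add: y_def of_nat_diff field_simps)
  qed
  ultimately have y: "y \<longlonglongrightarrow> 1 - a"
    using Lim_transform_eventually by force
  have "(\<lambda>T. q (x T) (y T)) \<longlonglongrightarrow> q a (1 - a)"
    unfolding q_def using gaussian_rate_denominator_pos[of s1 s2 a] assms
    by (intro tendsto_intros x y) auto
  moreover have "(\<lambda>T. 1 / sqrt (real T)) \<longlonglongrightarrow> 0" by real_asymp
  ultimately have "(\<lambda>T. (1 / sqrt (real T) + \<delta> * sqrt (q (x T) (y T)))\<^sup>2 / 2)
      \<longlonglongrightarrow> (0 + \<delta> * sqrt (q a (1 - a)))\<^sup>2 / 2"
    by (intro tendsto_intros) auto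
  also have "(0 + \<delta> * sqrt (q a (1 - a)))\<^sup>2 / 2 = gaussian_rate \<delta> s1 s2 a"
  proof -
    have "0 \<le> q a (1 - a)"
      unfolding q_def using gaussian_rate_denominator_pos[of s1 s2 a] assms by auto
    then show ?thesis
      using assms by (simp add: gaussian_rate_fraction q_def power_mult_distrib)
  qed
  finally have lim: "(\<lambda>T. (1 / sqrt (real T) + \<delta> * sqrt (q (x T) (y T)))\<^sup>2 / 2)
      \<longlonglongrightarrow> gaussian_rate \<delta> s1 s2 a" .
  have "\<forall>\<^sub>F T in sequentially. (1 / sqrt (real T) + \<delta> * sqrt (q (x T) (y T)))\<^sup>2 / 2
      = (1 / sqrt (real T) + \<delta> / sqrt (real T
              * (s1\<^sup>2 / real (K T + 1) + s2\<^sup>2 / real (T - K T + 1))))\<^sup>2 / 2"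
    using eventually_gt_at_top[of 0]
  proof eventually_elim
    case (elim T)
    have pos: "0 < x T" "0 < y T" using elim by (auto simp: x_def y_def)
    have "real T * (s1\<^sup>2 / real (K T + 1) + s2\<^sup>2 / real (T - K T + 1))
        = s1\<^sup>2 / x T + s2\<^sup>2 / y T"
      by (simp only: x_def y_def distrib_left divide_divide_eq_right times_divide_eq_right mult.commute)
    also have "\<dots> = 1 / q (x T) (y T)"
      using pos assms by (simp add: q_def add_frac_eq mult.commute)
    finally show ?case by (simp add: real_sqrt_divide)
  qed
  with lim show ?thesis by (rule Lim_transform_eventually)
qed

section \<open>Decay of the probability of false selection\<close>

context two_design_rs
begin

context
  assumes means: "\<mu> 2 < \<mu> 1" and sds: "0 < \<sigma> 1" "0 < \<sigma> 2" and p: "0 < p" "p < 1"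
begin

lemma prob_gap_bounds:
  assumes "0 < m" "0 < n"
  defines "v \<equiv> (\<sigma> 1)\<^sup>2 / real m + (\<sigma> 2)\<^sup>2 / real n"
  shows "prob {\<omega> \<in> space M. 0 < gap m n \<omega>} \<le> exp (- ((\<mu> 1 - \<mu> 2)\<^sup>2 / (2 * v)))"
    and "exp (- ((1 + (\<mu> 1 - \<mu> 2) / sqrt v)\<^sup>2 / 2)) / sqrt (2 * pi)
         \<le> prob {\<omega> \<in> space M. 0 < gap m n \<omega>}"
proof -
  have v: "0 < v" unfolding v_def using assms sds by (intro add_pos_pos) auto
  have "distributed M lborel (gap m n) (normal_density (- (\<mu> 1 - \<mu> 2)) (sqrt v))"
    using distributed_gap[of m n] assms sds by (simp add: v_def)
  note tail = normal_upper_tail_bounds[OF prob_space_axioms this]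
  show "prob {\<omega> \<in> space M. 0 < gap m n \<omega>} \<le> exp (- ((\<mu> 1 - \<mu> 2)\<^sup>2 / (2 * v)))"
    and "exp (- ((1 + (\<mu> 1 - \<mu> 2) / sqrt v)\<^sup>2 / 2)) / sqrt (2 * pi)
         \<le> prob {\<omega> \<in> space M. 0 < gap m n \<omega>}"
    using tail means v by simp_all
qed

lemma PFS_RS_upper:
  assumes "0 < T" and I: "\<And>b. b \<in> {0..1} \<Longrightarrow> I \<le> rate (\<mu> 1 - \<mu> 2) (\<sigma> 1) (\<sigma> 2) p b"
  shows "PFS_RS M X U T \<le> (real T + 1) * exp (- (real T * I))"
proof -
  have "PFS_RS M X U T = (\<Sum>k\<le>T. real (T choose k) * p ^ k * (1 - p) ^ (T - k)
           * prob {\<omega> \<in> space M. 0 < gap (k + 1) (T - k + 1) \<omega>})"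
    using p sds by (intro PFS_RS_eq_mixture) auto
  also have "\<dots> \<le> (\<Sum>k\<le>T. exp (- (real T * I)))"
  proof (rule sum_mono)
    fix k assume "k \<in> {..T}"
    then have k: "k \<le> T" by simp
    let ?a = "real k / real T" and ?d = "\<mu> 1 - \<mu> 2"
    let ?v = "(\<sigma> 1)\<^sup>2 / real (k + 1) + (\<sigma> 2)\<^sup>2 / real (T - k + 1)"
    have "real (T choose k) * p ^ k * (1 - p) ^ (T - k)
             * prob {\<omega> \<in> space M. 0 < gap (k + 1) (T - k + 1) \<omega>}
        \<le> exp (- (real T * kl ?a p)) * exp (- (?d\<^sup>2 / (2 * ?v)))"
      using k assms p by (intro mult_mono binomial_prob_kl_bounds prob_gap_bounds) auto
    also have "\<dots> = exp (- (real T * kl ?a p + ?d\<^sup>2 / (2 * ?v)))"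
      by (simp add: mult_exp_exp)
    also have "\<dots> \<le> exp (- (real T * I))"
    proof -
      have "real T * I \<le> real T * rate ?d (\<sigma> 1) (\<sigma> 2) p ?a"
        using k assms(1) by (intro mult_left_mono I) auto
      also have "\<dots> \<le> real T * kl ?a p + ?d\<^sup>2 / (2 * ?v)"
        using gaussian_rate_le_exponent[OF sds k assms(1), of ?d]
        unfolding rate_def distrib_left by linarith
      finally show ?thesis by simp
    qed
    finally show "real (T choose k) * p ^ k * (1 - p) ^ (T - k)
             * prob {\<omega> \<in> space M. 0 < gap (k + 1) (T - k + 1) \<omega>} \<le> exp (- (real T * I))" .
  qed
  also have "\<dots> = (real T + 1) * exp (- (real T * I))" by simp
  finally show ?thesis .
qed

text \<open>
  One term of the mixture is kept, with \<open>T\<close> factored out of its exponent so that the bound can be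
  compared with the rate function.
\<close>
lemma PFS_RS_lower:
  assumes "0 < T" "k \<le> T"
  defines "v \<equiv> (\<sigma> 1)\<^sup>2 / real (k + 1) + (\<sigma> 2)\<^sup>2 / real (T - k + 1)"
  shows "exp (- (real T * (kl (real k / real T) p
            + (1 / sqrt (real T) + (\<mu> 1 - \<mu> 2) / sqrt (real T * v))\<^sup>2 / 2)))
          / ((real T + 1) * sqrt (2 * pi)) \<le> PFS_RS M X U T"
proof -
  let ?d = "\<mu> 1 - \<mu> 2"
  let ?t = "\<lambda>k. real (T choose k) * p ^ k * (1 - p) ^ (T - k)
           * prob {\<omega> \<in> space M. 0 < gap (k + 1) (T - k + 1) \<omega>}"
  have "1 / sqrt (real T) + ?d / sqrt (real T * v) = (1 + ?d / sqrt v) / sqrt (real T)"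
    by (simp add: real_sqrt_mult add_divide_distrib mult.commute)
  then have "real T * ((1 / sqrt (real T) + ?d / sqrt (real T * v))\<^sup>2 / 2)
      = (1 + ?d / sqrt v)\<^sup>2 / 2"
    using assms(1) by (simp add: power_divide)
  then have "exp (- (real T * (kl (real k / real T) p
            + (1 / sqrt (real T) + ?d / sqrt (real T * v))\<^sup>2 / 2)))
          / ((real T + 1) * sqrt (2 * pi))
      = exp (- (real T * kl (real k / real T) p)) / (real T + 1)
        * (exp (- ((1 + ?d / sqrt v)\<^sup>2 / 2)) / sqrt (2 * pi))"
    by (simp only: distrib_left minus_add_distrib exp_add times_divide_times_eq)
  also have "\<dots> \<le> ?t k"
    unfolding v_def using assms p
    by (intro mult_mono binomial_prob_kl_bounds prob_gap_bounds) auto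
  also have "\<dots> \<le> (\<Sum>k\<le>T. ?t k)"
    using assms p by (intro member_le_sum) auto
  also have "\<dots> = PFS_RS M X U T"
    using p sds by (intro PFS_RS_eq_mixture[symmetric]) auto
  finally show ?thesis .
qed

text \<open>
  The number \<open>K\<close> of allocations to design 1 follows the minimizer \<open>a\<close> of the rate function, so
  that the lower bound from the term \<open>k = K\<close> has the same exponential rate as the upper bound
  from all \<open>T + 1\<close> terms.
\<close>
lemma PFS_RS_log_rate:
  "(\<lambda>T. - (1 / real T * ln (PFS_RS M X U T)))
     \<longlonglongrightarrow> (INF \<alpha>\<in>{0..1}. rate (\<mu> 1 - \<mu> 2) (\<sigma> 1) (\<sigma> 2) p \<alpha>)"
proof -
  let ?d = "\<mu> 1 - \<mu> 2"
  let ?r = "rate ?d (\<sigma> 1) (\<sigma> 2) p"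
  obtain a where a: "a \<in> {0..1}" and inf: "(INF \<alpha>\<in>{0..1}. ?r \<alpha>) = ?r a"
    and least: "\<And>b. b \<in> {0..1} \<Longrightarrow> ?r a \<le> ?r b"
    using rate_minimizer[OF sds p, of ?d] by blast
  define K where "K T = nat \<lfloor>a * real T\<rfloor>" for T
  have K: "K T \<le> T" for T
  proof -
    have "a * real T \<le> real T" using a mult_right_mono[of a 1 "real T"] by simp
    then show ?thesis unfolding K_def by linarith
  qed
  have frac_01: "real (K T) / real T \<in> {0..1}" for T
    using K[of T] by (cases "T = 0") auto
  define v where "v T = (\<sigma> 1)\<^sup>2 / real (K T + 1) + (\<sigma> 2)\<^sup>2 / real (T - K T + 1)" for T
  define e where "e T = kl (real (K T) / real T) p
    + (1 / sqrt (real T) + ?d / sqrt (real T * v T))\<^sup>2 / 2" for T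
  have frac: "(\<lambda>T. real (K T) / real T) \<longlonglongrightarrow> a"
    unfolding K_def using a by (intro tendsto_floor_fraction) auto
  have lower: "exp (- (real T * e T)) / ((real T + 1) * sqrt (2 * pi)) \<le> PFS_RS M X U T"
    if "0 < T" for T
    unfolding e_def v_def using PFS_RS_lower[OF that K] .
  have "(\<lambda>T. kl (real (K T) / real T) p) \<longlonglongrightarrow> kl a p"
    by (intro continuous_on_tendsto_compose[OF continuous_on_kl[OF p] frac a]
        always_eventually allI frac_01)
  moreover have "(\<lambda>T. (1 / sqrt (real T) + ?d / sqrt (real T * v T))\<^sup>2 / 2)
      \<longlonglongrightarrow> gaussian_rate ?d (\<sigma> 1) (\<sigma> 2) a"
    unfolding v_def using tendsto_tail_exponent[OF sds a K frac] means by simp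
  ultimately have e: "e \<longlonglongrightarrow> ?r a"
    unfolding e_def[abs_def] rate_def by (subst add.commute) (rule tendsto_add)
  show ?thesis unfolding inf
  proof (rule tendsto_sandwich)
    show "\<forall>\<^sub>F T in sequentially.
        ?r a - ln (real T + 1) / real T \<le> - (1 / real T * ln (PFS_RS M X U T))"
      using eventually_gt_at_top[of 0]
    proof eventually_elim
      case (elim T)
      have "0 < PFS_RS M X U T" by (rule less_le_trans[OF _ lower[OF elim]]) simp
      then have "ln (PFS_RS M X U T) \<le> ln ((real T + 1) * exp (- (real T * ?r a)))"
        using PFS_RS_upper[OF elim least] by simp
      also have "\<dots> = ln (real T + 1) - real T * ?r a"
        by (simp add: ln_mult)
      finally have "ln (PFS_RS M X U T) / real T \<le> (ln (real T + 1) - real T * ?r a) / real T"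
        by (rule divide_right_mono) simp
      then show ?case using elim by (simp add: diff_divide_distrib)
    qed
    show "\<forall>\<^sub>F T in sequentially.
        - (1 / real T * ln (PFS_RS M X U T)) \<le> e T + ln ((real T + 1) * sqrt (2 * pi)) / real T"
      using eventually_gt_at_top[of 0]
    proof eventually_elim
      case (elim T)
      have "- (real T * e T) - ln ((real T + 1) * sqrt (2 * pi))
          = ln (exp (- (real T * e T)) / ((real T + 1) * sqrt (2 * pi)))"
        by (simp add: ln_div)
      also have "\<dots> \<le> ln (PFS_RS M X U T)"
        by (intro ln_mono lower elim) auto
      finally show ?case using elim by (simp add: field_simps)
    qed
    have "(\<lambda>T. ?r a - ln (real T + 1) / real T) \<longlonglongrightarrow> ?r a - 0"
      by (intro tendsto_diff tendsto_const) real_asymp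
    then show "(\<lambda>T. ?r a - ln (real T + 1) / real T) \<longlonglongrightarrow> ?r a" by simp
    have "(\<lambda>T. e T + ln ((real T + 1) * sqrt (2 * pi)) / real T) \<longlonglongrightarrow> ?r a + 0"
      by (intro tendsto_add e) real_asymp
    then show "(\<lambda>T. e T + ln ((real T + 1) * sqrt (2 * pi)) / real T) \<longlonglongrightarrow> ?r a" by simp
  qed
qed

end

end

theorem theorem4p1:
  fixes M :: "'a measure"
    and X :: "nat \<Rightarrow> nat \<Rightarrow> 'a \<Rightarrow> real"
    and U :: "nat \<Rightarrow> 'a \<Rightarrow> bool"
    and \<mu> \<sigma> :: "nat \<Rightarrow> real"
    and p \<delta> :: real
  assumes "two_design_rs M X U \<mu> \<sigma> p"
    and "\<mu> 1 > \<mu> 2"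
    and "\<delta> = \<mu> 1 - \<mu> 2"
    and "\<sigma> 1 > 0" and "\<sigma> 2 > 0"
    and "0 < p" and "p < 1"
  shows "(\<lambda>T. - (1 / real T * ln (PFS_RS M X U T)))
           \<longlonglongrightarrow> (INF \<alpha>\<in>{0..1}. gaussian_rate \<delta> (\<sigma> 1) (\<sigma> 2) \<alpha> + kl \<alpha> p)"
  using two_design_rs.PFS_RS_log_rate[OF assms(1,2,4,5,6,7)]
  unfolding rate_def assms(3) .

end
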